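(* Let $(G,p)$, $G=(V,E)$, $|V|=n$, be a completely regular minimally rigid framework on a smooth two-dimensional manifold $M\subset\mathbb{R}^3$. Then $$2n-|E|=d(M,p)$$ and for each subgraph $G'$ of $G$ with $|E(G')|>0$, $$2|V(G')|-|E(G')|\ge d(M,p'),$$ where $p'$ is the restriction of $p$ to $V(G')$.
   Context: Frameworks. $M\subset\mathbb{R}^3$ is a smooth embedded two-dimensional submanifold, not necessarily connected. For a finite simple connected graph $G=(V,E)$ with $V=\{v_1,\dots,v_n\}$, a framework $(G,p)$ on $M$ is given by $p=(p_1,\dots,p_n)\in M^n$, with $p_i$ the point assigned to $v_i$. For a subgraph $H$ of $G$ (not necessarily connected), $(H,p)$ denotes $H$ together with the restriction of $p$ to $V(H)$; $K_n$ denotes the complete graph on $V$. Rigidity. $V_M(G,p)$ is the set of $q\in M^n$ with $|q_i-q_j|^2=|p_i-p_j|^2$ for all edges $v_iv_j$ of $G$. $(G,p)$ is (continuously) rigid if for every continuous path $p:[0,1]\to V_M(G,p)$ with $p(0)=p$ there is $\delta>0$ with $p([0,\delta))\subseteq V_M(K_n,p)$. It is minimally rigid if it is rigid and, for every edge $e$ of $G$, $(G\setminus e,p)$ is not rigid. Regularity. Near each $p_i$ let $M$ be given by $h_i=0$, where $h_i$ is a smooth function near $p_i$ with nonvanishing gradient. The augmented edge function is $\tilde f_G(q)=\big((|q_i-q_j|^2)_{v_iv_j\in E},h_1(q_1),\dots,h_n(q_n)\big)$, defined for $q\in\mathbb{R}^{3n}$ near $p$. $(G,p)$ is regular on $M$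 if the rank of the derivative $D\tilde f_G$ at $p$ is maximal among its ranks at points of some neighbourhood of $p$ in $\mathbb{R}^{3n}$. $(G,p)$ is completely regular if $(H,p)$ is regular on $M$ for each subgraph $H$ of $G$. Degrees of freedom. The number of ambient degrees of freedom at $p=(p_1,\dots,p_n)$ is $d(M,p)=\dim\ker D\tilde f_{K_n}(p)$; for $p'$ it is defined in the same way with the complete graph on $V(G')$. *)

theory Defs
  imports "HOL-Analysis.Analysis"
begin

section \<open>Smooth maps and surfaces\<close>

text \<open>The two predicates below are meant for open sets and finite-dimensional spaces, where
  quantifying over directions is the same as asking for all iterated partial derivatives.\<close>

primrec Ck_on :: "nat \<Rightarrow> ('a::real_normed_vector \<Rightarrow> 'b::real_normed_vector) \<Rightarrow> 'a set \<Rightarrow> bool" where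
  "Ck_on 0 f S = continuous_on S f"
| "Ck_on (Suc k) f S =
     ((\<forall>x\<in>S. f differentiable (at x)) \<and> (\<forall>v. Ck_on k (\<lambda>x. frechet_derivative f (at x) v) S))"

definition smooth_on :: "('a::real_normed_vector \<Rightarrow> 'b::real_normed_vector) \<Rightarrow> 'a set \<Rightarrow> bool" where
  "smooth_on f S \<longleftrightarrow> (\<forall>k. Ck_on k f S)"

text \<open>Embedded surface: local slice charts, i.e. diffeomorphisms between open subsets of the
  ambient space that flatten \<open>M\<close> to a coordinate plane.\<close>

definition embedded_surface :: "(real^3) set \<Rightarrow> bool" where
  "embedded_surface M \<longleftrightarrow>
     (\<forall>x\<in>M. \<exists>U (W :: (real^3) set) \<phi> \<psi>. open U \<and> x \<in> U \<and> open W \<and> homeomorphism U W \<phi> \<psi> \<and>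
        smooth_on \<phi> U \<and> smooth_on \<psi> W \<and> \<phi> ` (M \<inter> U) = {w\<in>W. w $ 3 = 0})"

definition local_defining_function :: "(real^3) set \<Rightarrow> real^3 \<Rightarrow> (real^3 \<Rightarrow> real) \<Rightarrow> bool" where
  "local_defining_function M x h \<longleftrightarrow>
     (\<exists>U. open U \<and> x \<in> U \<and> smooth_on h U \<and>
        (\<forall>y\<in>U. frechet_derivative h (at y) \<noteq> (\<lambda>_. 0)) \<and> M \<inter> U = {y\<in>U. h y = 0})"

section \<open>Graphs\<close>

text \<open>A graph is a pair of a vertex set and a set of two-element subsets of it.\<close>

definition complete_edges :: "'v set \<Rightarrow> 'v set set" where
  "complete_edges V = {e. e \<subseteq> V \<and> card e = 2}"

definition simple_graph :: "'v set \<Rightarrow> 'v set set \<Rightarrow> bool" where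
  "simple_graph V E \<longleftrightarrow> finite V \<and> E \<subseteq> complete_edges V"

definition connected_graph :: "'v set \<Rightarrow> 'v set set \<Rightarrow> bool" where
  "connected_graph V E \<longleftrightarrow> V \<noteq> {} \<and> (\<forall>u\<in>V. \<forall>v\<in>V. (u, v) \<in> {(a, b). {a, b} \<in> E}\<^sup>*)"

definition subgraph_of :: "'v set \<Rightarrow> 'v set set \<Rightarrow> 'v set \<Rightarrow> 'v set set \<Rightarrow> bool" where
  "subgraph_of V' E' V E \<longleftrightarrow> simple_graph V' E' \<and> V' \<subseteq> V \<and> E' \<subseteq> E"

section \<open>Configurations\<close>

text \<open>Vertices are taken from a finite type, and for a vertex set \<open>V\<close> the space of
  configurations, of dimension \<open>3 * card V\<close>, is realised as the subspace of those
  configurations of the whole type that vanish off \<open>V\<close>.  This lets \<open>V\<close> vary over the vertex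
  sets of subgraphs.\<close>

definition confs :: "'v::finite set \<Rightarrow> ((real^3)^'v) set" where
  "confs V = {q. \<forall>i. i \<notin> V \<longrightarrow> q $ i = 0}"

definition confs_in :: "(real^3) set \<Rightarrow> 'v::finite set \<Rightarrow> ((real^3)^'v) set" where
  "confs_in M V = {q \<in> confs V. \<forall>i\<in>V. q $ i \<in> M}"

definition restrict_conf :: "'v::finite set \<Rightarrow> (real^3)^'v \<Rightarrow> (real^3)^'v" where
  "restrict_conf V p = (\<chi> i. if i \<in> V then p $ i else 0)"

text \<open>Squared distance between the endpoints of an edge (well defined by symmetry, see below).\<close>

definition sq_length :: "(real^3)^'v::finite \<Rightarrow> 'v set \<Rightarrow> real" where
  "sq_length q e = (THE d. \<exists>i j. e = {i, j} \<and> d = (norm (q $ i - q $ j))\<^sup>2)"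

lemma sq_length_edge: "sq_length q {i, j} = (norm (q $ i - q $ j))\<^sup>2"
  unfolding sq_length_def
  by (rule the_equality) (auto simp: doubleton_eq_iff norm_minus_commute)

section \<open>Rigidity\<close>

definition realisations ::
  "(real^3) set \<Rightarrow> 'v::finite set \<Rightarrow> 'v set set \<Rightarrow> (real^3)^'v \<Rightarrow> ((real^3)^'v) set" where
  "realisations M V E p = {q \<in> confs_in M V. \<forall>e\<in>E. sq_length q e = sq_length p e}"

definition rigid :: "(real^3) set \<Rightarrow> 'v::finite set \<Rightarrow> 'v set set \<Rightarrow> (real^3)^'v \<Rightarrow> bool" where
  "rigid M V E p \<longleftrightarrow>
     (\<forall>\<gamma>. path \<gamma> \<and> path_image \<gamma> \<subseteq> realisations M V E p \<and> pathstart \<gamma> = p \<longrightarrow>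
        (\<exists>\<delta>. 0 < \<delta> \<and> \<delta> \<le> 1 \<and> \<gamma> ` {0..<\<delta>} \<subseteq> realisations M V (complete_edges V) p))"

definition minimally_rigid ::
  "(real^3) set \<Rightarrow> 'v::finite set \<Rightarrow> 'v set set \<Rightarrow> (real^3)^'v \<Rightarrow> bool" where
  "minimally_rigid M V E p \<longleftrightarrow> rigid M V E p \<and> (\<forall>e\<in>E. \<not> rigid M V (E - {e}) p)"

section \<open>Regularity and degrees of freedom\<close>

text \<open>In the codomain of the augmented edge function, the coordinates that belong to no edge or
  vertex of the graph are padded with zero; this affects neither ranks nor kernels.\<close>

definition aug_edge_fun ::
  "('v::finite \<Rightarrow> real^3 \<Rightarrow> real) \<Rightarrow> 'v set \<Rightarrow> 'v set set \<Rightarrow> (real^3)^'v \<Rightarrow> (real^('v set)) \<times> (real^'v)"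
  where
  "aug_edge_fun h V E q =
     ((\<chi> e. if e \<in> E then sq_length q e else 0), (\<chi> i. if i \<in> V then h i (q $ i) else 0))"

definition aug_deriv ::
  "('v::finite \<Rightarrow> real^3 \<Rightarrow> real) \<Rightarrow> 'v set \<Rightarrow> 'v set set \<Rightarrow> (real^3)^'v \<Rightarrow>
     (real^3)^'v \<Rightarrow> (real^('v set)) \<times> (real^'v)" where
  "aug_deriv h V E q = frechet_derivative (aug_edge_fun h V E) (at q)"

definition aug_rank ::
  "('v::finite \<Rightarrow> real^3 \<Rightarrow> real) \<Rightarrow> 'v set \<Rightarrow> 'v set set \<Rightarrow> (real^3)^'v \<Rightarrow> nat" where
  "aug_rank h V E q = dim (aug_deriv h V E q ` confs V)"

definition regular ::
  "('v::finite \<Rightarrow> real^3 \<Rightarrow> real) \<Rightarrow> 'v set \<Rightarrow> 'v set set \<Rightarrow> (real^3)^'v \<Rightarrow> bool" where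
  "regular h V E p \<longleftrightarrow>
     (\<exists>N. open N \<and> p \<in> N \<and> (\<forall>q \<in> N \<inter> confs V. aug_rank h V E q \<le> aug_rank h V E p))"

definition completely_regular ::
  "('v::finite \<Rightarrow> real^3 \<Rightarrow> real) \<Rightarrow> 'v set \<Rightarrow> 'v set set \<Rightarrow> (real^3)^'v \<Rightarrow> bool" where
  "completely_regular h V E p \<longleftrightarrow>
     (\<forall>V' E'. subgraph_of V' E' V E \<longrightarrow> regular h V' E' (restrict_conf V' p))"

text \<open>For local defining functions \<open>h\<close> of \<open>M\<close> near the points of \<open>p\<close> this is \<open>d(M,p)\<close>, where \<open>p\<close>
  is a configuration of \<open>V\<close>.\<close>

definition ambient_dof ::
  "('v::finite \<Rightarrow> real^3 \<Rightarrow> real) \<Rightarrow> 'v set \<Rightarrow> (real^3)^'v \<Rightarrow> nat" where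
  "ambient_dof h V p = dim {u \<in> confs V. aug_deriv h V (complete_edges V) p u = 0}"

end

theory Submission
  imports Defs
begin

text \<open>
  Write \<open>F\<close> for the augmented edge function of \<open>G\<close>. Its derivative at \<open>p\<close> has one row for each edge
  and one for each vertex, acting on a space of dimension \<open>3n\<close>. Two facts give the equation: the rows
  are linearly independent, so that the kernel has dimension \<open>3n - |E| - n\<close>, and this kernel is the
  kernel for the complete graph, whose dimension is \<open>d(M,p)\<close>. The inequality then costs nothing more:
  the rows of a subgraph are among those of \<open>G\<close>, so they are independent too, and the kernel of the
  complete graph on its vertices is contained in its own kernel.

  Both facts come from the constant rank theorem. Regularity says that the rank of \<open>DF\<close> has a local
  maximum at \<open>p\<close>, hence is constant nearby, and so the fibre of \<open>F\<close> through \<open>p\<close> is near \<open>p\<close> a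
  manifold with tangent space \<open>ker DF(p)\<close>.

  \<^item> Every \<open>u\<close> in \<open>ker DF(p)\<close> is the initial velocity of a curve in the fibre
    (\<open>constant_rank_curve_in_fibre\<close>). When \<open>G\<close> is rigid, all distances between vertices stay constant
    along the beginning of this curve, and differentiating at \<open>0\<close> puts \<open>u\<close> into the kernel for the
    complete graph (\<open>rigid_imp_infinitesimally_rigid\<close>).

  \<^item> If the rows were dependent, then, as the gradients of the \<open>h i\<close> do not vanish, some edge \<open>e\<close>
    would occur in a dependency, so that forgetting the coordinate \<open>e\<close> is injective on the range of
    \<open>DF(p)\<close>. Near \<open>p\<close> the image of \<open>F\<close> is a manifold with this range as tangent space, on which
    forgetting \<open>e\<close> is therefore still injective near \<open>F(p)\<close>
    (\<open>constant_rank_fibres_through_injective_map\<close>). So near \<open>p\<close> the realisations of \<open>G\<close> without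
    \<open>e\<close> are those of \<open>G\<close>, and \<open>G\<close> without \<open>e\<close> is rigid, against minimality.
\<close>

section \<open>Linear algebra\<close>

lemma rank_nullity_on_subspace:
  fixes f :: "'a::euclidean_space \<Rightarrow> 'b::euclidean_space"
  assumes f: "linear f" and S: "subspace S"
  shows "dim (f ` S) + dim {x\<in>S. f x = 0} = dim S"
proof -
  define K where "K = {x\<in>S. f x = 0}"
  define C where "C = {y\<in>S. \<forall>x\<in>K. orthogonal x y}"
  have K: "subspace K"
    unfolding K_def using S f
    by (auto simp: subspace_def linear_0 linear_add linear_cmul)
  have C: "subspace C"
    unfolding C_def using S
    by (auto simp: subspace_def orthogonal_def inner_add_right)
  have "inj_on f C"
  proof (rule inj_onI)
    fix x y assume xy: "x \<in> C" "y \<in> C" "f x = f y"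
    then have "x - y \<in> C" "x - y \<in> K"
      using C subspace_diff[OF S] f unfolding C_def K_def
      by (auto simp: subspace_diff linear_diff orthogonal_def inner_diff_right)
    then have "orthogonal (x - y) (x - y)"
      unfolding C_def by blast
    then show "x = y" by (simp add: orthogonal_self)
  qed
  then have "inj_on f (span C)"
    by (simp only: span_eq_iff[THEN iffD2, OF C])
  then have "dim (f ` C) = dim C"
    using f by (intro dim_image_eq)
  moreover have "f ` S \<subseteq> f ` C"
  proof (rule image_subsetI)
    fix x assume x: "x \<in> S"
    obtain y z where y: "y \<in> span K" and z: "\<And>w. w \<in> span K \<Longrightarrow> orthogonal z w" and xyz: "x = y + z"
      using orthogonal_subspace_decomp_exists[of K x] by metis
    have yK: "y \<in> K" using y K by (metis span_eq_iff)
    have "z = x - y" using xyz by simp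
    then have "z \<in> S" using x yK subspace_diff[OF S] by (auto simp: K_def)
    then have "z \<in> C"
      using z by (auto simp: C_def orthogonal_commute span_base)
    moreover have "f x = f z" using xyz yK f by (simp add: K_def linear_add)
    ultimately show "f x \<in> f ` C" by blast
  qed
  moreover have "f ` C \<subseteq> f ` S" unfolding C_def by blast
  moreover have "dim C + dim K = dim S"
    unfolding C_def using K S by (intro dim_subspace_orthogonal_to_vectors) (auto simp: K_def)
  ultimately show ?thesis unfolding K_def by auto
qed

lemma same_kernel_same_rank:
  fixes f :: "'a::euclidean_space \<Rightarrow> 'b::euclidean_space" and g :: "'a \<Rightarrow> 'c::euclidean_space"
  assumes "linear f" "linear g" "\<And>x. f x = 0 \<longleftrightarrow> g x = 0"
  shows "dim (range f) = dim (range g)"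
  using rank_nullity_on_subspace[OF assms(1) subspace_UNIV]
    rank_nullity_on_subspace[OF assms(2) subspace_UNIV] assms(3) by simp

lemma dim_vectors_supported_on:
  "dim {x :: 'a::euclidean_space^'n. \<forall>i. i \<notin> S \<longrightarrow> x $ i = 0} = DIM('a) * card S"
proof -
  define d :: "('a^'n) set" where "d = (\<lambda>(i, b). axis i b) ` (S \<times> Basis)"
  have d: "d \<subseteq> Basis" unfolding d_def by auto
  have mem: "axis i b \<in> d \<longleftrightarrow> i \<in> S" if "b \<in> Basis" for i and b :: 'a
    using that nonzero_Basis by (auto simp: d_def axis_eq_axis image_iff)
  have "{x :: 'a^'n. \<forall>i. i \<notin> S \<longrightarrow> x $ i = 0} = {x. \<forall>i\<in>Basis. i \<notin> d \<longrightarrow> x \<bullet> i = 0}"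
    by (auto simp: Basis_vec_def inner_axis mem euclidean_all_zero_iff intro: euclidean_eqI)
  moreover have "card d = DIM('a) * card S"
    unfolding d_def using nonzero_Basis
    by (subst card_image) (auto simp: inj_on_def axis_eq_axis card_cartesian_product)
  ultimately show ?thesis using dim_substandard[OF d] by simp
qed

section \<open>Fibres of maps of constant rank\<close>

text \<open>A chart in which the fibre is flat, as in the constant rank theorem. The map \<open>B\<close> is a partial inverse of
  the derivative at \<open>p\<close>: the hypotheses make \<open>Q = B \<circ> F' p\<close> a projection whose kernel is the kernel
  of \<open>F' p\<close>. The perturbation \<open>\<Phi>\<close> of the identity has derivative \<open>id + Q - Q = id\<close> at \<open>p\<close>, so it has a
  local inverse \<open>\<Psi>\<close>, and the last conclusion says that near \<open>\<Phi> p\<close> it maps the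
  translate of \<open>ker Q\<close> through \<open>\<Phi> p\<close> into the fibre of \<open>F\<close>.

  The reason is that \<open>Q \<circ> \<Phi>'(q) = B \<circ> F'(q)\<close>. As \<open>\<Phi>'(q)\<close> is onto, \<open>B \<circ> F'(q)\<close> has the rank of \<open>Q\<close>,
  which is that of \<open>F' p\<close>; by the rank bound \<open>B\<close> is then injective on the range of \<open>F'(q)\<close>.
  Moving \<open>\<Phi>(q)\<close> in a direction of \<open>ker Q\<close> therefore leaves \<open>F\<close> unchanged to first order.\<close>

lemma constant_rank_chart:
  fixes F :: "'a::euclidean_space \<Rightarrow> 'b::euclidean_space"
    and F' :: "'a \<Rightarrow> 'a \<Rightarrow>\<^sub>L 'b" and B :: "'b \<Rightarrow>\<^sub>L 'a" and p :: 'a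
  defines "\<Phi> \<equiv> \<lambda>q. q + B (F q) - B (F' p q)"
  assumes U: "open U" "p \<in> U"
    and F: "\<And>q. q \<in> U \<Longrightarrow> (F has_derivative F' q) (at q)" and cont: "continuous_on U F'"
    and rank: "\<And>q. q \<in> U \<Longrightarrow> dim (range (F' q)) \<le> dim (range (F' p))"
    and idem: "\<And>y. B (F' p (B y)) = B y"
    and ker: "\<And>u. B (F' p u) = 0 \<Longrightarrow> F' p u = 0"
  obtains N e \<Psi> where "open N" "p \<in> N" "e > 0"
    "\<And>q. q \<in> N \<Longrightarrow> norm (\<Phi> q - \<Phi> p) < e \<and> \<Psi> (\<Phi> q) = q"
    "(\<Psi> has_derivative (\<lambda>u. u)) (at (\<Phi> p))"
    "continuous_on (ball (\<Phi> p) e) \<Psi>"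
    "\<And>k. norm k < e \<Longrightarrow> B (F' p k) = 0 \<Longrightarrow> F (\<Psi> (\<Phi> p + k)) = F p"
proof -
  define \<Phi>' where "\<Phi>' = (\<lambda>q. id_blinfun + (B o\<^sub>L F' q) - (B o\<^sub>L F' p))"
  have d\<Phi>: "(\<Phi> has_derivative \<Phi>' q) (at q)" if "q \<in> U" for q
    unfolding \<Phi>_def \<Phi>'_def
    by (rule derivative_eq_intros bounded_linear.has_derivative[OF blinfun.bounded_linear_right] F that refl)+
       (simp add: blinfun.bilinear_simps fun_eq_iff)
  have c\<Phi>: "continuous_on U \<Phi>'"
    unfolding \<Phi>'_def by (intro continuous_intros cont)
  have \<Phi>'p: "id_blinfun o\<^sub>L \<Phi>' p = id_blinfun"
    by (rule blinfun_eqI) (simp add: \<Phi>'_def blinfun.bilinear_simps)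
  obtain U' W \<Psi> \<Psi>' where U': "open U'" "U' \<subseteq> U" "p \<in> U'" and W: "open W" "\<Phi> p \<in> W"
    and homeo: "homeomorphism U' W \<Phi> \<Psi>"
    and d\<Psi>: "\<And>y. y \<in> W \<Longrightarrow> (\<Psi> has_derivative (\<Psi>' y)) (at y)"
    and \<Psi>': "\<And>y. y \<in> W \<Longrightarrow> \<Psi>' y = inv (blinfun_apply (\<Phi>' (\<Psi> y)))"
    and bij: "\<And>y. y \<in> W \<Longrightarrow> bij (blinfun_apply (\<Phi>' (\<Psi> y)))"
    using inverse_function_theorem[OF U(1) d\<Phi> c\<Phi> U(2) \<Phi>'p] by blast
  obtain e where e: "e > 0" "ball (\<Phi> p) e \<subseteq> W"
    using W openE by blast
  define N where "N = \<Psi> ` ball (\<Phi> p) e"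
  have \<Psi>W: "\<Psi> y \<in> U'" "\<Phi> (\<Psi> y) = y" if "y \<in> W" for y
    using homeo that by (auto simp: homeomorphism_def)
  have \<Psi>\<Phi>: "\<Psi> (\<Phi> q) = q" if "q \<in> U'" for q
    using homeo that by (auto simp: homeomorphism_def)
  have "openin (top_of_set U') (\<Psi> ` ball (\<Phi> p) e)"
    using homeomorphism_imp_open_map[OF homeomorphism_symD[OF homeo], of "ball (\<Phi> p) e"] e
    by (simp add: openin_open_eq W)
  then have N: "open N" "N \<subseteq> U'"
    unfolding N_def using openin_open_trans[OF _ U'(1)] openin_imp_subset by metis+
  \<comment> \<open>To first order, \<open>F\<close> does not change in directions that \<open>\<Phi>\<close> sends into \<open>ker Q\<close>.\<close>
  have fibre: "F' q v = 0" if q: "q \<in> U" and bijq: "bij (\<Phi>' q)" and k: "B (F' p (\<Phi>' q v)) = 0" for q v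
  proof -
    have Q\<Phi>': "B (F' p (\<Phi>' q w)) = B (F' q w)" for w
      by (simp add: \<Phi>'_def blinfun.bilinear_simps idem)
    have "range (\<lambda>w. B (F' q w)) = range (\<lambda>w. B (F' p w))"
      using image_image[of "\<lambda>w. B (F' p w)" "\<Phi>' q" UNIV] bij_is_surj[OF bijq]
      by (simp only: Q\<Phi>')
    moreover have "dim (range (\<lambda>w. B (F' p w))) = dim (range (F' p))"
      by (rule same_kernel_same_rank)
         (auto simp: ker blinfun.bilinear_simps intro!: linearI)
    ultimately have r: "dim (range (\<lambda>w. B (F' q w))) \<ge> dim (range (F' q))"
      using rank[OF q] by simp
    have lin: "linear (blinfun_apply B)" "linear (blinfun_apply (F' q))"
      by (simp_all add: blinfun.bounded_linear_right bounded_linear.linear)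
    have "dim {x \<in> range (F' q). B x = 0} = 0"
      using rank_nullity_on_subspace[OF lin(1) linear_subspace_image[OF lin(2) subspace_UNIV]] r
      unfolding image_image by linarith
    then have "{x \<in> range (F' q). B x = 0} \<subseteq> {0}" by simp
    then show "F' q v = 0" using k Q\<Phi>' by auto
  qed
  have const: "F (\<Psi> (\<Phi> p + k)) = F p" if k: "norm k < e" "B (F' p k) = 0" for k
  proof -
    define c where "c = (\<lambda>t. \<Psi> (\<Phi> p + t *\<^sub>R k))"
    have W01: "\<Phi> p + t *\<^sub>R k \<in> W" if "t \<in> {0..1}" for t
    proof -
      have "norm (t *\<^sub>R k) \<le> norm k"
        using that by (simp add: mult_left_le_one_le)
      then show ?thesis using k e by (auto simp: dist_norm)
    qed
    have "((\<lambda>t. F (c t)) has_derivative (\<lambda>h. 0)) (at t within {0..1})" if t: "t \<in> {0..1}" for t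
    proof -
      let ?y = "\<Phi> p + t *\<^sub>R k"
      have 1: "((\<lambda>t. \<Phi> p + t *\<^sub>R k) has_derivative (\<lambda>h. h *\<^sub>R k)) (at t within {0..1})"
        by (auto intro!: derivative_eq_intros)
      have c: "(c has_derivative (\<lambda>h. \<Psi>' ?y (h *\<^sub>R k))) (at t within {0..1})"
        unfolding c_def by (rule has_derivative_compose[OF 1 d\<Psi>[OF W01[OF t]]])
      have "c t \<in> U" using \<Psi>W W01[OF t] U'(2) by (auto simp: c_def)
      then have "((\<lambda>t. F (c t)) has_derivative (\<lambda>h. F' (c t) (\<Psi>' ?y (h *\<^sub>R k)))) (at t within {0..1})"
        by (intro has_derivative_compose[OF c F])
      moreover have "F' (c t) (\<Psi>' ?y (h *\<^sub>R k)) = 0" for h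
      proof (rule fibre[OF \<open>c t \<in> U\<close>])
        show "bij (\<Phi>' (c t))" using bij[OF W01[OF t]] by (simp add: c_def)
        then have "\<Phi>' (c t) (\<Psi>' ?y (h *\<^sub>R k)) = h *\<^sub>R k"
          using \<Psi>'[OF W01[OF t]] by (simp add: c_def bij_is_surj surj_f_inv_f)
        then show "B (F' p (\<Phi>' (c t) (\<Psi>' ?y (h *\<^sub>R k)))) = 0"
          by (simp add: blinfun.bilinear_simps k)
      qed
      ultimately show ?thesis by simp
    qed
    then have "F (c 0) = F (c 1)"
      by (intro has_derivative_zero_unique[where s = "{0..1}"]) auto
    then show ?thesis
      using \<Psi>\<Phi>[OF U'(3)] by (simp add: c_def)
  qed
  show ?thesis
  proof (rule that[OF N(1) _ e(1)])
    show "p \<in> N" unfolding N_def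
      by (metis U'(3) \<Psi>\<Phi> centre_in_ball e(1) image_eqI)
    show "norm (\<Phi> q - \<Phi> p) < e \<and> \<Psi> (\<Phi> q) = q" if "q \<in> N" for q
      using that e \<Psi>W unfolding N_def by (auto simp: dist_norm norm_minus_commute)
    have "blinfun_apply (\<Phi>' p) = id"
      by (simp add: \<Phi>'_def fun_eq_iff blinfun.bilinear_simps)
    then have "\<Psi>' (\<Phi> p) = inv id"
      using \<Psi>'[OF W(2)] \<Psi>\<Phi>[OF U'(3)] by (simp only:)
    then have "\<Psi>' (\<Phi> p) = (\<lambda>u. u)"
      by (simp add: id_def)
    then show "(\<Psi> has_derivative (\<lambda>u. u)) (at (\<Phi> p))"
      using d\<Psi>[OF W(2)] by simp
    show "continuous_on (ball (\<Phi> p) e) \<Psi>"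
      using homeo e(2) continuous_on_subset homeomorphism_def by metis
    show "F (\<Psi> (\<Phi> p + k)) = F p" if "norm k < e" "B (F' p k) = 0" for k
      using const that .
  qed
qed

text \<open>Supplies the partial inverse for \<open>constant_rank_chart\<close>, with \<open>B0 \<circ> A\<close> for \<open>B\<close>: it inverts \<open>A \<circ> L\<close> on
  the orthogonal complement of \<open>ker L\<close> and takes its values there.\<close>

lemma adapted_left_inverse:
  fixes L :: "'a::euclidean_space \<Rightarrow> 'b::euclidean_space" and A :: "'b \<Rightarrow> 'c::euclidean_space"
  assumes L: "linear L" and A: "linear A" and inj: "\<And>u. A (L u) = 0 \<Longrightarrow> L u = 0"
  obtains B0 :: "'c \<Rightarrow> 'a" where "linear B0"
    "\<And>y. B0 (A (L (B0 y))) = B0 y" "\<And>u. B0 (A (L u)) = 0 \<Longrightarrow> L u = 0"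
proof -
  define K where "K = {x. L x = 0}"
  define C where "C = {y. \<forall>x\<in>K. orthogonal x y}"
  have K: "subspace K" unfolding K_def by (rule linear_subspace_kernel[OF L])
  have C: "subspace C" unfolding C_def
    by (auto simp: subspace_def orthogonal_def inner_add_right)
  have AL: "linear (\<lambda>u. A (L u))" using linear_compose[OF L A] by (simp add: o_def)
  have "inj_on (\<lambda>u. A (L u)) C"
  proof (rule inj_onI)
    fix x y assume xy: "x \<in> C" "y \<in> C" "A (L x) = A (L y)"
    then have "A (L (x - y)) = 0" using linear_diff[OF AL] by simp
    then have "x - y \<in> K" using inj by (auto simp: K_def)
    moreover have "x - y \<in> C" using xy C by (auto simp: subspace_diff)
    ultimately have "orthogonal (x - y) (x - y)" unfolding C_def by blast
    then show "x = y" by (simp add: orthogonal_self)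
  qed
  then obtain B0 where B0: "range B0 \<subseteq> C" "linear B0" "\<forall>v\<in>C. B0 (A (L v)) = v"
    using linear_exists_left_inverse_on[OF AL C] by blast
  show ?thesis
  proof (rule that[OF B0(2)])
    show "B0 (A (L (B0 y))) = B0 y" for y using B0 by auto
    fix u assume u: "B0 (A (L u)) = 0"
    obtain y z where y: "y \<in> span K" and z: "\<And>w. w \<in> span K \<Longrightarrow> orthogonal z w" and xyz: "u = y + z"
      using orthogonal_subspace_decomp_exists[of K u] by metis
    have yK: "y \<in> K" using y K by (metis span_eq_iff)
    have "z \<in> C" using z by (auto simp: C_def orthogonal_commute span_base)
    moreover have "L u = L z" using xyz yK linear_add[OF L] by (simp add: K_def)
    ultimately have "z = 0" using B0 u by auto
    then show "L u = 0" using \<open>L u = L z\<close> linear_0[OF L] by simp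
  qed
qed

text \<open>In the chart with \<open>B = B0 \<circ> A\<close>, the value of \<open>\<Phi>\<close> at a point with \<open>A (F q) = A (F p)\<close> differs from
  \<open>\<Phi> p\<close> by \<open>(q - p) - Q (q - p)\<close>, a vector of \<open>ker Q\<close>. Hence \<open>q\<close> lies on the slice on which \<open>F\<close> is
  constant.\<close>

lemma constant_rank_fibres_through_injective_map:
  fixes F :: "'a::euclidean_space \<Rightarrow> 'b::euclidean_space" and F' :: "'a \<Rightarrow> 'a \<Rightarrow>\<^sub>L 'b"
    and A :: "'b \<Rightarrow> 'c::euclidean_space"
  assumes U: "open U" "p \<in> U"
    and F: "\<And>q. q \<in> U \<Longrightarrow> (F has_derivative F' q) (at q)" and cont: "continuous_on U F'"
    and rank: "\<And>q. q \<in> U \<Longrightarrow> dim (range (F' q)) \<le> dim (range (F' p))"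
    and A: "linear A" and inj: "\<And>u. A (F' p u) = 0 \<Longrightarrow> F' p u = 0"
  obtains N where "open N" "p \<in> N" "\<And>q. q \<in> N \<Longrightarrow> A (F q) = A (F p) \<Longrightarrow> F q = F p"
proof -
  obtain B0 :: "'c \<Rightarrow> 'a" where B0: "linear B0" "\<And>y. B0 (A (F' p (B0 y))) = B0 y"
    "\<And>u. B0 (A (F' p u)) = 0 \<Longrightarrow> F' p u = 0"
    using adapted_left_inverse[OF bounded_linear.linear[OF blinfun.bounded_linear_right] A inj] by blast
  define B where "B = Blinfun (\<lambda>y. B0 (A y))"
  have B: "B y = B0 (A y)" for y
    unfolding B_def using linear_compose[OF A B0(1)]
    by (subst bounded_linear_Blinfun_apply) (auto simp: o_def linear_conv_bounded_linear)
  define y0 where "y0 = p + B (F p) - B (F' p p)"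
  obtain N e \<Psi> where N: "open N" "p \<in> N"
    and \<Psi>: "\<And>q. q \<in> N \<Longrightarrow> norm (q + B (F q) - B (F' p q) - y0) < e \<and>
         \<Psi> (q + B (F q) - B (F' p q)) = q"
    and const: "\<And>k. norm k < e \<Longrightarrow> B (F' p k) = 0 \<Longrightarrow>
        F (\<Psi> (y0 + k)) = F p"
    using constant_rank_chart[OF U F cont rank, of B] B B0(2,3) unfolding y0_def by metis
  show ?thesis
  proof (rule that[OF N])
    fix q assume q: "q \<in> N" "A (F q) = A (F p)"
    define k where "k = q + B (F q) - B (F' p q) - y0"
    have "B (F q) = B (F p)" using q by (simp add: B)
    then have "k = (q - p) - B (F' p (q - p))"
      by (simp add: k_def y0_def blinfun.bilinear_simps)
    moreover have "B (F' p (B y)) = B y" for y using B0(2) by (simp add: B)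
    ultimately have "B (F' p k) = 0" by (simp add: blinfun.bilinear_simps)
    moreover have "y0 + k = q + B (F q) - B (F' p q)"
      by (simp add: k_def)
    then have "norm k < e" and "\<Psi> (y0 + k) = q"
      using \<Psi>[OF q(1)] by (simp_all only: k_def)
    ultimately show "F q = F p"
      using const by metis
  qed
qed

text \<open>The straight line in direction \<open>u\<close>, carried into the fibre by the chart \<open>\<Psi>\<close>, whose derivative at
  the base point is the identity.\<close>

lemma constant_rank_curve_in_fibre:
  fixes F :: "'a::euclidean_space \<Rightarrow> 'b::euclidean_space" and F' :: "'a \<Rightarrow> 'a \<Rightarrow>\<^sub>L 'b"
  assumes U: "open U" "p \<in> U"
    and F: "\<And>q. q \<in> U \<Longrightarrow> (F has_derivative F' q) (at q)" and cont: "continuous_on U F'"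
    and rank: "\<And>q. q \<in> U \<Longrightarrow> dim (range (F' q)) \<le> dim (range (F' p))"
    and u: "F' p u = 0"
  obtains \<gamma> e where "e > 0" "continuous_on {0..e} \<gamma>" "\<gamma> 0 = p"
    "(\<gamma> has_vector_derivative u) (at 0)" "\<And>t. t \<in> {0..e} \<Longrightarrow> F (\<gamma> t) = F p"
proof -
  obtain B0 :: "'b \<Rightarrow> 'a" where B0: "linear B0" "\<And>y. B0 (F' p (B0 y)) = B0 y"
    "\<And>v. B0 (F' p v) = 0 \<Longrightarrow> F' p v = 0"
    using adapted_left_inverse[OF bounded_linear.linear[OF blinfun.bounded_linear_right] linear_ident] by blast
  define B where "B = Blinfun B0"
  have B: "B y = B0 y" for y
    unfolding B_def using B0(1)
    by (simp add: bounded_linear_Blinfun_apply linear_conv_bounded_linear)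
  define y0 where "y0 = p + B (F p) - B (F' p p)"
  obtain N e \<Psi> where N: "p \<in> N" and e: "e > 0"
    and \<Psi>: "\<And>q. q \<in> N \<Longrightarrow> \<Psi> (q + B (F q) - B (F' p q)) = q"
    and d\<Psi>: "(\<Psi> has_derivative (\<lambda>u. u)) (at y0)"
    and c\<Psi>: "continuous_on (ball y0 e) \<Psi>"
    and const: "\<And>k. norm k < e \<Longrightarrow> B (F' p k) = 0 \<Longrightarrow> F (\<Psi> (y0 + k)) = F p"
    using constant_rank_chart[OF U F cont rank, of B] B B0(2,3) unfolding y0_def by metis
  define d where "d = e / (norm u + 1)"
  have d: "d > 0" unfolding d_def using e by (simp add: add_nonneg_pos)
  have small: "norm (t *\<^sub>R u) < e" if "t \<in> {0..d}" for t
  proof -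
    have "norm (t *\<^sub>R u) \<le> d * norm u" using that by (simp add: mult_right_mono)
    also have "\<dots> < d * (norm u + 1)" using d by simp
    also have "\<dots> = e" unfolding d_def by (simp add: add_nonneg_eq_0_iff)
    finally show ?thesis .
  qed
  show ?thesis
  proof (rule that[OF d])
    let ?\<gamma> = "\<lambda>t. \<Psi> (y0 + t *\<^sub>R u)"
    show "continuous_on {0..d} ?\<gamma>"
      using small by (intro continuous_on_compose2[OF c\<Psi>] continuous_intros) (auto simp: dist_norm)
    show "?\<gamma> 0 = p" using \<Psi>[OF N] by (simp add: y0_def)
    have "((\<lambda>t. y0 + t *\<^sub>R u) has_derivative (\<lambda>h. h *\<^sub>R u)) (at (0::real))"
      by (auto intro!: derivative_eq_intros)
    moreover have "(\<Psi> has_derivative (\<lambda>u. u)) (at (y0 + 0 *\<^sub>R u))" using d\<Psi> by simp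
    ultimately show "(?\<gamma> has_vector_derivative u) (at 0)"
      unfolding has_vector_derivative_def by (rule has_derivative_compose)
    show "F (?\<gamma> t) = F p" if "t \<in> {0..d}" for t
      using const[OF small[OF that]] u by (simp add: blinfun.bilinear_simps)
  qed
qed

section \<open>The derivative of the augmented edge function\<close>

lemma has_derivative_vec_lambda_real:
  fixes f :: "'a::real_normed_vector \<Rightarrow> 'n::finite \<Rightarrow> real"
  assumes "\<And>i. ((\<lambda>x. f x i) has_derivative (\<lambda>u. f' u i)) (at a within S)"
  shows "((\<lambda>x. \<chi> i. f x i) has_derivative (\<lambda>u. \<chi> i. f' u i)) (at a within S)"
  by (subst has_derivative_componentwise_within) (auto simp: Basis_vec_def inner_axis assms)

definition edge_deriv :: "(real^3)^'v::finite \<Rightarrow> 'v set \<Rightarrow> (real^3)^'v \<Rightarrow> real" where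
  "edge_deriv q e u = frechet_derivative (\<lambda>x. sq_length x e) (at q) u"

lemma sq_length_has_derivative_doubleton:
  fixes q :: "(real^3)^'v::finite"
  shows "((\<lambda>x. sq_length x {i, j}) has_derivative (\<lambda>u. 2 * ((q $ i - q $ j) \<bullet> (u $ i - u $ j)))) (at q)"
proof -
  have d: "((\<lambda>x. x $ i - x $ j) has_derivative (\<lambda>u. u $ i - u $ j)) (at q)"
    by (intro has_derivative_diff bounded_linear_imp_has_derivative bounded_linear_vec_nth)
  show ?thesis
    unfolding sq_length_edge power2_norm_eq_inner
    using has_derivative_inner[OF d d] by (simp add: inner_commute)
qed

lemma edge_deriv_doubleton: "edge_deriv q {i, j} u = 2 * ((q $ i - q $ j) \<bullet> (u $ i - u $ j))"
  by (simp only: edge_deriv_def frechet_derivative_at[OF sq_length_has_derivative_doubleton, symmetric])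

lemma complete_edges_doubleton:
  assumes "E \<subseteq> complete_edges V" "e \<in> E"
  obtains i j where "e = {i, j}" "i \<in> V" "j \<in> V"
  using assms unfolding complete_edges_def by (auto simp: card_2_iff)

lemma sq_length_has_derivative:
  assumes "e \<in> complete_edges V"
  shows "((\<lambda>x. sq_length x e) has_derivative edge_deriv q e) (at q)"
proof -
  obtain i j where e: "e = {i, j}" using assms complete_edges_doubleton by blast
  show ?thesis
    unfolding e edge_deriv_doubleton[abs_def] by (rule sq_length_has_derivative_doubleton)
qed

text \<open>The augmented edge function is defined on configurations of the whole vertex type, but depends
  only on the vertices of the graph. The following lemmas make it possible to work in the whole
  Euclidean space, where fibres can be treated by the inverse function theorem, and to return to
  the configurations of \<open>V\<close> by restriction.\<close>

lemma restrict_conf_nth: "restrict_conf V q $ i = (if i \<in> V then q $ i else 0)"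
  by (simp add: restrict_conf_def)

lemma restrict_conf_confs: "restrict_conf V q \<in> confs V"
  by (simp add: confs_def restrict_conf_nth)

lemma restrict_conf_id: "q \<in> confs V \<Longrightarrow> restrict_conf V q = q"
  by (auto simp: confs_def restrict_conf_nth vec_eq_iff)

lemma linear_restrict_conf: "linear (restrict_conf V)"
  by (auto intro!: linearI simp: vec_eq_iff restrict_conf_nth)

lemma sq_length_restrict_conf:
  assumes "e \<in> complete_edges V" shows "sq_length (restrict_conf V q) e = sq_length q e"
  using assms
  by (auto simp: sq_length_edge restrict_conf_nth elim!: complete_edges_doubleton[OF order_refl])

lemma edge_deriv_restrict_conf:
  assumes "e \<in> complete_edges V"
  shows "edge_deriv (restrict_conf V q) e u = edge_deriv q e u"
    and "edge_deriv q e (restrict_conf V u) = edge_deriv q e u"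
  using assms
  by (auto simp: edge_deriv_doubleton restrict_conf_nth elim!: complete_edges_doubleton[OF order_refl])

lemma aug_edge_fun_restrict_conf:
  assumes "E \<subseteq> complete_edges V"
  shows "aug_edge_fun h V E (restrict_conf V q) = aug_edge_fun h V E q"
  using assms
  by (auto simp: aug_edge_fun_def vec_eq_iff restrict_conf_nth sq_length_restrict_conf subsetD)

lemma aug_edge_fun_has_derivative:
  fixes q :: "(real^3)^'v::finite"
  assumes E: "E \<subseteq> complete_edges V" and h: "\<And>i. i \<in> V \<Longrightarrow> h i differentiable (at (q $ i))"
  shows "(aug_edge_fun h V E has_derivative
     (\<lambda>u. (\<chi> e. if e \<in> E then edge_deriv q e u else 0,
           \<chi> i. if i \<in> V then frechet_derivative (h i) (at (q $ i)) (u $ i) else 0))) (at q)"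
proof -
  have "((\<lambda>x. if e \<in> E then sq_length x e else 0) has_derivative
      (\<lambda>u. if e \<in> E then edge_deriv q e u else 0)) (at q)" for e
    using sq_length_has_derivative[OF subsetD[OF E]] by (cases "e \<in> E") simp_all
  moreover have "((\<lambda>x. if i \<in> V then h i (x $ i) else 0) has_derivative
      (\<lambda>u. if i \<in> V then frechet_derivative (h i) (at (q $ i)) (u $ i) else 0)) (at q)" for i
  proof (cases "i \<in> V")
    case True
    have "((\<lambda>x. h i (x $ i)) has_derivative (\<lambda>u. frechet_derivative (h i) (at (q $ i)) (u $ i))) (at q)"
      by (rule has_derivative_compose[OF bounded_linear_imp_has_derivative[OF bounded_linear_vec_nth]
            frechet_derivative_works[THEN iffD1, OF h[OF True]]])
    then show ?thesis using True by simp
  qed simp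
  ultimately show ?thesis
    unfolding aug_edge_fun_def[abs_def]
    by (intro has_derivative_Pair has_derivative_vec_lambda_real)
qed

lemma aug_deriv_eq:
  assumes "E \<subseteq> complete_edges V" "\<And>i. i \<in> V \<Longrightarrow> h i differentiable (at (q $ i))"
  shows "aug_deriv h V E q u = (\<chi> e. if e \<in> E then edge_deriv q e u else 0,
           \<chi> i. if i \<in> V then frechet_derivative (h i) (at (q $ i)) (u $ i) else 0)"
  by (simp only: aug_deriv_def frechet_derivative_at[OF aug_edge_fun_has_derivative[OF assms], symmetric])

section \<open>Frameworks near a configuration on a surface\<close>

text \<open>The open sets \<open>W i\<close> are neighbourhoods on which the local defining functions describe \<open>M\<close>. Fixing
  them makes the neighbourhood \<open>U\<close> of \<open>p\<close> below the same for all graphs on \<open>V\<close>, and the \<open>W i\<close>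
  also serve the restriction of \<open>p\<close> to a smaller vertex set.\<close>

locale surface_framework =
  fixes M :: "(real^3) set" and V :: "'v::finite set" and p :: "(real^3)^'v"
    and h :: "'v \<Rightarrow> real^3 \<Rightarrow> real" and W :: "'v \<Rightarrow> (real^3) set"
  assumes p: "p \<in> confs_in M V"
    and open_W: "i \<in> V \<Longrightarrow> open (W i)" and p_in_W: "i \<in> V \<Longrightarrow> p $ i \<in> W i"
    and smooth_h: "i \<in> V \<Longrightarrow> smooth_on (h i) (W i)"
    and gradient: "i \<in> V \<Longrightarrow> y \<in> W i \<Longrightarrow> frechet_derivative (h i) (at y) \<noteq> (\<lambda>_. 0)"
    and level_set: "i \<in> V \<Longrightarrow> M \<inter> W i = {y \<in> W i. h i y = 0}"
begin

definition U :: "((real^3)^'v) set" where "U = {q. \<forall>i\<in>V. q $ i \<in> W i}"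

lemma open_U: "open U"
proof -
  have "U = (\<Inter>i\<in>V. (\<lambda>q. q $ i) -` W i)" by (auto simp: U_def)
  then show ?thesis
    by (auto intro!: open_INT open_vimage open_W continuous_intros)
qed

lemma p_in_U: "p \<in> U" using p_in_W by (simp add: U_def)

lemma restrict_p: "restrict_conf V p = p"
  using p restrict_conf_id by (auto simp: confs_in_def)

lemma restrict_conf_in_U: "restrict_conf V q \<in> U \<longleftrightarrow> q \<in> U"
  by (simp add: U_def restrict_conf_nth)

lemma in_M_iff: "i \<in> V \<Longrightarrow> y \<in> W i \<Longrightarrow> y \<in> M \<longleftrightarrow> h i y = 0"
  using level_set[of i] by blast

lemma differentiable_h: "i \<in> V \<Longrightarrow> y \<in> W i \<Longrightarrow> h i differentiable (at y)"
  using smooth_h[of i] unfolding smooth_on_def by (auto dest!: spec[of _ 1])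

lemma continuous_dh:
  assumes "i \<in> V" shows "continuous_on U (\<lambda>q. frechet_derivative (h i) (at (q $ i)) (v $ i))"
proof -
  have "continuous_on (W i) (\<lambda>y. frechet_derivative (h i) (at y) (v $ i))"
    using smooth_h[OF assms] unfolding smooth_on_def by (auto dest!: spec[of _ 1])
  then show ?thesis
    by (rule continuous_on_compose2[where f = "\<lambda>q. q $ i"])
       (use assms in \<open>auto simp: U_def intro!: continuous_intros\<close>)
qed

context
  fixes E :: "'v set set"
  assumes E: "E \<subseteq> complete_edges V"
begin

lemma aug_deriv: "q \<in> U \<Longrightarrow> aug_deriv h V E q u =
    (\<chi> e. if e \<in> E then edge_deriv q e u else 0,
     \<chi> i. if i \<in> V then frechet_derivative (h i) (at (q $ i)) (u $ i) else 0)"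
  using differentiable_h by (intro aug_deriv_eq E) (auto simp: U_def)

lemma has_aug_deriv:
  assumes "q \<in> U" shows "(aug_edge_fun h V E has_derivative aug_deriv h V E q) (at q)"
  unfolding ext[of "aug_deriv h V E q", OF aug_deriv[OF assms]]
  using assms differentiable_h by (intro aug_edge_fun_has_derivative E) (auto simp: U_def)

lemma linear_aug_deriv: "q \<in> U \<Longrightarrow> linear (aug_deriv h V E q)"
  using has_aug_deriv has_derivative_linear by blast

lemma aug_deriv_restrict_conf:
  assumes "q \<in> U"
  shows "aug_deriv h V E (restrict_conf V q) u = aug_deriv h V E q u"
    and "aug_deriv h V E q (restrict_conf V u) = aug_deriv h V E q u"
  using assms E
  by (auto simp: aug_deriv restrict_conf_in_U vec_eq_iff edge_deriv_restrict_conf subsetD restrict_conf_nth)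

definition aug_blinfun where "aug_blinfun q = Blinfun (aug_deriv h V E q)"

lemma aug_blinfun: "q \<in> U \<Longrightarrow> blinfun_apply (aug_blinfun q) = aug_deriv h V E q"
  unfolding aug_blinfun_def using has_aug_deriv has_derivative_bounded_linear
  by (intro bounded_linear_Blinfun_apply) blast

lemma continuous_aug_blinfun: "continuous_on U aug_blinfun"
proof (rule continuous_on_blinfun_componentwise)
  fix u :: "(real^3)^'v"
  have "continuous_on U (\<lambda>q. if e \<in> E then edge_deriv q e u else 0)" for e
  proof (cases "e \<in> E")
    case True
    then obtain i j where e: "e = {i, j}" using E complete_edges_doubleton by blast
    show ?thesis using True unfolding e edge_deriv_doubleton by (auto intro!: continuous_intros)
  qed simp
  moreover have "continuous_on U
      (\<lambda>q. if i \<in> V then frechet_derivative (h i) (at (q $ i)) (u $ i) else 0)" for i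
    using continuous_dh by (cases "i \<in> V") auto
  ultimately have "continuous_on U (\<lambda>q. (\<chi> e. if e \<in> E then edge_deriv q e u else 0,
     \<chi> i. if i \<in> V then frechet_derivative (h i) (at (q $ i)) (u $ i) else 0))"
    by (intro continuous_on_Pair continuous_on_vec_lambda)
  then show "continuous_on U (\<lambda>q. aug_blinfun q u)"
    by (simp add: aug_blinfun aug_deriv cong: continuous_on_cong)
qed

lemma range_aug_deriv: "q \<in> U \<Longrightarrow> aug_deriv h V E q ` confs V = range (aug_deriv h V E q)"
  using aug_deriv_restrict_conf(2)[of q] restrict_conf_confs[of V]
  by (auto simp: image_iff) metis

text \<open>Regularity bounds the rank only at configurations of \<open>V\<close>; since restriction to \<open>V\<close> does not
  change the derivative, the bound holds on a full neighbourhood of \<open>p\<close>.\<close>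

lemma regular_rank_bound:
  assumes "regular h V E p"
  obtains N where "open N" "p \<in> N" "N \<subseteq> U"
    "\<And>q. q \<in> N \<Longrightarrow> dim (range (aug_blinfun q)) \<le> dim (range (aug_blinfun p))"
proof -
  obtain N where N: "open N" "p \<in> N"
    and le: "\<And>q. q \<in> N \<inter> confs V \<Longrightarrow> aug_rank h V E q \<le> aug_rank h V E p"
    using assms unfolding regular_def by blast
  show ?thesis
  proof (rule that[of "U \<inter> restrict_conf V -` N"])
    show "open (U \<inter> restrict_conf V -` N)"
      by (intro open_Int open_U open_vimage N linear_continuous_on linear_restrict_conf
          linear_conv_bounded_linear[THEN iffD1])
    show "p \<in> U \<inter> restrict_conf V -` N" using N p_in_U restrict_p by simp
    fix q assume q: "q \<in> U \<inter> restrict_conf V -` N"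
    then have "aug_rank h V E (restrict_conf V q) \<le> aug_rank h V E p"
      by (intro le) (auto simp: restrict_conf_confs)
    moreover have "aug_deriv h V E (restrict_conf V q) = aug_deriv h V E q"
      using q aug_deriv_restrict_conf(1) by blast
    ultimately show "dim (range (aug_blinfun q)) \<le> dim (range (aug_blinfun p))"
      using q p_in_U by (simp add: aug_rank_def range_aug_deriv aug_blinfun)
  qed simp
qed

lemma realisations_iff_fibre:
  assumes "q \<in> U" "q \<in> confs V"
  shows "q \<in> realisations M V E p \<longleftrightarrow> aug_edge_fun h V E q = aug_edge_fun h V E p"
proof -
  have "q $ i \<in> M \<longleftrightarrow> h i (q $ i) = h i (p $ i)" if i: "i \<in> V" for i
    using assms(1) p p_in_W[OF i] in_M_iff[OF i] i by (auto simp: U_def confs_in_def)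
  then show ?thesis
    using assms(2)
    unfolding realisations_def confs_in_def aug_edge_fun_def prod.inject vec_eq_iff vec_lambda_beta mem_Collect_eq
    by meson
qed

end

end

section \<open>Counting dimensions\<close>

text \<open>The coordinates of the codomain that belong to an edge or a vertex of the graph; the derivative has
  linearly independent rows precisely when its range is this space.\<close>

definition aug_codomain :: "'v::finite set \<Rightarrow> 'v set set \<Rightarrow> ((real^('v set)) \<times> (real^'v)) set" where
  "aug_codomain V E = {a. \<forall>e. e \<notin> E \<longrightarrow> a $ e = 0} \<times> {b. \<forall>i. i \<notin> V \<longrightarrow> b $ i = 0}"

lemma dim_aug_codomain:
  fixes V :: "'v::finite set"
  shows "dim (aug_codomain V E) = card E + card V"
proof -
  have "subspace {x :: real^'v set. \<forall>e. e \<notin> E \<longrightarrow> x $ e = 0}"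
    "subspace {x :: real^'v. \<forall>i. i \<notin> V \<longrightarrow> x $ i = 0}"
    by (auto simp: subspace_def)
  then show ?thesis
    by (simp add: aug_codomain_def dim_Times dim_vectors_supported_on)
qed

lemma subspace_aug_codomain: "subspace (aug_codomain V E)"
  by (auto simp: aug_codomain_def subspace_def zero_prod_def)

lemma subspace_confs: "subspace (confs V)"
  by (auto simp: confs_def subspace_def)

lemma dim_confs: "dim (confs V) = 3 * card V"
  unfolding confs_def by (simp add: dim_vectors_supported_on)

section \<open>Rigidity and the rank of the derivative\<close>

lemma continuous_on_interval_initially_in_open:
  fixes \<gamma> :: "real \<Rightarrow> 'a::topological_space"
  assumes "continuous_on {0..b} \<gamma>" "0 < b" "open N" "\<gamma> 0 \<in> N"
  obtains d where "0 < d" "d \<le> b" "\<And>t. t \<in> {0..d} \<Longrightarrow> \<gamma> t \<in> N"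
proof -
  obtain T where T: "open T" "0 \<in> T" "\<And>t. t \<in> {0..b} \<Longrightarrow> t \<in> T \<Longrightarrow> \<gamma> t \<in> N"
    using assms unfolding continuous_on_topological by (metis atLeastAtMost_iff less_imp_le order_refl)
  then obtain e where e: "e > 0" "cball 0 e \<subseteq> T" by (meson open_contains_cball)
  show ?thesis
  proof (rule that[of "min e b"])
    fix t assume t: "t \<in> {0..min e b}"
    then have "t \<in> cball 0 e" by (simp add: dist_real_def)
    then have "t \<in> T" using e by blast
    then show "\<gamma> t \<in> N" using T(3) t by simp
  qed (use e assms in auto)
qed

context surface_framework begin

text \<open>The premise on \<open>e\<close> says that its row is a combination of the others. The realisations near \<open>p\<close> are
  then not affected by removing \<open>e\<close>, so that a path of realisations of the smaller graph starts as a
  path of realisations of the larger one.\<close>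

lemma redundant_edge:
  assumes E: "E \<subseteq> complete_edges V" and reg: "regular h V E p" and rigid: "rigid M V E p"
    and redundant: "\<And>u. aug_deriv h V (E - {e}) p u = 0 \<Longrightarrow> aug_deriv h V E p u = 0"
  shows "rigid M V (E - {e}) p"
proof -
  have E': "E - {e} \<subseteq> complete_edges V" using E by blast
  define A :: "(real^('v set)) \<times> (real^'v) \<Rightarrow> (real^('v set)) \<times> (real^'v)"
    where "A = (\<lambda>(a, b). (\<chi> f. if f = e then 0 else a $ f, b))"
  have A: "linear A"
    by (auto intro!: linearI simp: A_def vec_eq_iff split: prod.splits)
  have AF: "A (aug_edge_fun h V E q) = aug_edge_fun h V (E - {e}) q" for q
    by (auto simp: A_def aug_edge_fun_def vec_eq_iff)
  have AD: "A (aug_deriv h V E p u) = aug_deriv h V (E - {e}) p u" for u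
    by (auto simp: A_def aug_deriv[OF E p_in_U] aug_deriv[OF E' p_in_U] vec_eq_iff)
  obtain N0 where N0: "open N0" "p \<in> N0" "N0 \<subseteq> U"
    and rank: "\<And>q. q \<in> N0 \<Longrightarrow> dim (range (aug_blinfun E q)) \<le> dim (range (aug_blinfun E p))"
    using regular_rank_bound[OF E reg] by blast
  have deriv: "(aug_edge_fun h V E has_derivative aug_blinfun E q) (at q)" if "q \<in> N0" for q
    using has_aug_deriv[OF E] aug_blinfun[OF E] N0 that by (metis subsetD)
  have inj: "aug_blinfun E p u = 0" if "A (aug_blinfun E p u) = 0" for u
    using that redundant by (simp add: aug_blinfun[OF E p_in_U] AD)
  obtain N where N: "open N" "p \<in> N"
    and fibre: "\<And>q. q \<in> N \<Longrightarrow> A (aug_edge_fun h V E q) = A (aug_edge_fun h V E p) \<Longrightarrow>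
      aug_edge_fun h V E q = aug_edge_fun h V E p"
    using constant_rank_fibres_through_injective_map[OF N0(1,2) deriv
        continuous_on_subset[OF continuous_aug_blinfun[OF E] N0(3)] rank A inj] by metis
  have same: "q \<in> realisations M V E p"
    if "q \<in> N \<inter> N0" "q \<in> realisations M V (E - {e}) p" for q
  proof -
    have q: "q \<in> U" "q \<in> confs V"
      using that N0 by (auto simp: realisations_def confs_in_def)
    show ?thesis
      using that fibre realisations_iff_fibre[OF E q] realisations_iff_fibre[OF E' q]
      by (simp add: AF)
  qed
  show ?thesis
    unfolding rigid_def
  proof (intro allI impI, elim conjE)
    fix \<gamma> assume \<gamma>: "path \<gamma>" "path_image \<gamma> \<subseteq> realisations M V (E - {e}) p" "pathstart \<gamma> = p"
    then obtain d where d: "0 < d" "d \<le> 1" "\<And>t. t \<in> {0..d} \<Longrightarrow> \<gamma> t \<in> N \<inter> N0"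
      using continuous_on_interval_initially_in_open[of 1 \<gamma> "N \<inter> N0"] N N0
      by (auto simp: path_def pathstart_def)
    have "subpath 0 d \<gamma> t \<in> realisations M V E p" if "t \<in> {0..1}" for t
    proof -
      have dt: "d * t \<in> {0..d}" "d * t \<in> {0..1}"
        using that d by (auto simp: mult_left_le mult_le_one)
      have "\<gamma> (d * t) \<in> realisations M V (E - {e}) p"
        using dt(2) \<gamma>(2) by (auto simp: path_image_def)
      then show ?thesis
        using same[OF d(3)[OF dt(1)]] by (simp add: subpath_def)
    qed
    then have "path_image (subpath 0 d \<gamma>) \<subseteq> realisations M V E p"
      by (auto simp: path_image_def)
    moreover have "path (subpath 0 d \<gamma>)"
      using \<gamma>(1) d by simp
    moreover have "pathstart (subpath 0 d \<gamma>) = p"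
      using \<gamma>(3) by (simp add: pathstart_def subpath_def)
    ultimately obtain \<delta> where \<delta>: "0 < \<delta>" "\<delta> \<le> 1"
      "subpath 0 d \<gamma> ` {0..<\<delta>} \<subseteq> realisations M V (complete_edges V) p"
      using rigid[unfolded rigid_def, rule_format, of "subpath 0 d \<gamma>"] by blast
    have "\<gamma> t \<in> realisations M V (complete_edges V) p" if "t \<in> {0..<d * \<delta>}" for t
    proof -
      have "t / d \<in> {0..<\<delta>}" "subpath 0 d \<gamma> (t / d) = \<gamma> t"
        using that d by (auto simp: field_simps subpath_def)
      then show ?thesis using \<delta>(3) by (metis image_subset_iff)
    qed
    then show "\<exists>\<delta>>0. \<delta> \<le> 1 \<and> \<gamma> ` {0..<\<delta>} \<subseteq> realisations M V (complete_edges V) p"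
      using d \<delta> by (intro exI[of _ "d * \<delta>"]) (auto simp: mult_le_one)
  qed
qed

text \<open>An infinitesimal flex \<open>u\<close> is the velocity of a curve in the fibre. Rigidity makes an initial piece of it, restricted
  to \<open>V\<close>, a curve of realisations of the complete graph, so the derivative of the complete augmented
  edge function along \<open>u\<close> vanishes.\<close>

lemma rigid_imp_infinitesimally_rigid:
  assumes E: "E \<subseteq> complete_edges V" and reg: "regular h V E p" and rigid: "rigid M V E p"
    and u: "aug_deriv h V E p u = 0"
  shows "aug_deriv h V (complete_edges V) p u = 0"
proof -
  let ?K = "complete_edges V"
  obtain N0 where N0: "open N0" "p \<in> N0" "N0 \<subseteq> U"
    and rank: "\<And>q. q \<in> N0 \<Longrightarrow> dim (range (aug_blinfun E q)) \<le> dim (range (aug_blinfun E p))"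
    using regular_rank_bound[OF E reg] by blast
  have deriv: "(aug_edge_fun h V E has_derivative aug_blinfun E q) (at q)" if "q \<in> N0" for q
    using has_aug_deriv[OF E] aug_blinfun[OF E] N0 that by (metis subsetD)
  have "aug_blinfun E p u = 0" using u by (simp add: aug_blinfun[OF E p_in_U])
  then obtain \<gamma> b where b: "0 < b" and cont: "continuous_on {0..b} \<gamma>" and start: "\<gamma> 0 = p"
    and velocity: "(\<gamma> has_vector_derivative u) (at 0)"
    and fibre: "\<And>t. t \<in> {0..b} \<Longrightarrow> aug_edge_fun h V E (\<gamma> t) = aug_edge_fun h V E p"
    using constant_rank_curve_in_fibre[OF N0(1,2) deriv
        continuous_on_subset[OF continuous_aug_blinfun[OF E] N0(3)] rank] by metis
  obtain d where d: "0 < d" "d \<le> b" "\<And>t. t \<in> {0..d} \<Longrightarrow> \<gamma> t \<in> U"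
    using continuous_on_interval_initially_in_open[OF cont b open_U] start p_in_U by metis
  \<comment> \<open>Reparametrised over the unit interval, and with the coordinates outside \<open>V\<close>, on which the fibre
    puts no constraint, set to zero.\<close>
  define \<eta> where "\<eta> = (\<lambda>s. restrict_conf V (\<gamma> (d * s)))"
  have "path \<eta>"
    unfolding path_def \<eta>_def using d
    by (intro continuous_on_compose2[OF linear_continuous_on continuous_on_compose2[OF cont]]
        continuous_intros linear_conv_bounded_linear[THEN iffD1] linear_restrict_conf)
       (auto simp: mult_left_le intro: order_trans[of _ d])
  moreover have "\<eta> s \<in> realisations M V E p" if "s \<in> {0..1}" for s
  proof -
    have ds: "d * s \<in> {0..d}" "d * s \<in> {0..b}"
      using that d by (auto simp: mult_left_le intro: order_trans[of _ d])
    then show ?thesis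
      using d(3) fibre
      by (simp add: realisations_iff_fibre[OF E] \<eta>_def restrict_conf_in_U restrict_conf_confs
          aug_edge_fun_restrict_conf[OF E])
  qed
  moreover have "pathstart \<eta> = p"
    by (simp add: pathstart_def \<eta>_def start restrict_p)
  ultimately obtain \<delta> where \<delta>: "0 < \<delta>" "\<delta> \<le> 1"
    "\<eta> ` {0..<\<delta>} \<subseteq> realisations M V ?K p"
    using rigid unfolding rigid_def path_image_def by (metis image_subsetI)
  have const: "aug_edge_fun h V ?K (\<gamma> t) = aug_edge_fun h V ?K p" if t: "t \<in> {0..d * \<delta> / 2}" for t
  proof -
    have "0 < d * \<delta>" using d \<delta> by simp
    then have "t < d * \<delta>" "0 \<le> t" using t by auto
    then have "t / d \<in> {0..<\<delta>}" using d by (simp add: field_simps)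
    moreover have "\<eta> (t / d) = restrict_conf V (\<gamma> t)" using d by (simp add: \<eta>_def)
    ultimately have "restrict_conf V (\<gamma> t) \<in> realisations M V ?K p"
      using \<delta>(3) by (metis image_subset_iff)
    moreover have "d * \<delta> / 2 \<le> d" using d \<delta> by (simp add: field_simps)
    then have "\<gamma> t \<in> U" using d(3) t by simp
    ultimately show ?thesis
      by (simp add: realisations_iff_fibre restrict_conf_in_U restrict_conf_confs
          aug_edge_fun_restrict_conf)
  qed
  have "((\<lambda>t. aug_edge_fun h V ?K (\<gamma> t)) has_derivative (\<lambda>s. aug_deriv h V ?K p (s *\<^sub>R u))) (at 0)"
    using velocity has_aug_deriv[OF order_refl p_in_U] start
    by (auto simp: has_vector_derivative_def intro: has_derivative_compose)
  then have "((\<lambda>t. aug_edge_fun h V ?K (\<gamma> t)) has_vector_derivative aug_deriv h V ?K p u) (at 0)"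
    using linear_aug_deriv[OF order_refl p_in_U] by (simp add: has_vector_derivative_def linear_cmul)
  then have "((\<lambda>t. aug_edge_fun h V ?K (\<gamma> t)) has_vector_derivative aug_deriv h V ?K p u)
      (at 0 within cbox 0 (d * \<delta> / 2))"
    by (rule has_vector_derivative_at_within)
  moreover have "((\<lambda>t. aug_edge_fun h V ?K (\<gamma> t)) has_vector_derivative 0)
      (at 0 within cbox 0 (d * \<delta> / 2))"
    by (rule has_vector_derivative_transform[OF _ _ has_vector_derivative_const])
       (use const d \<delta> in auto)
  ultimately show ?thesis
    using d \<delta> by (intro vector_derivative_unique_within_closed_interval[of 0 "d * \<delta> / 2" 0]) auto
qed

text \<open>A vector \<open>(\<omega>, \<mu>)\<close> of the codomain that is orthogonal to the range is a linear dependency between the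
  rows (a stress). Its edge part cannot vanish, because the rows of the vertices, which are the
  gradients of the \<open>h i\<close> placed in separate blocks, are independent. So some edge is redundant.\<close>

lemma minimally_rigid_imp_full_rank:
  assumes E: "E \<subseteq> complete_edges V" and reg: "regular h V E p" and min: "minimally_rigid M V E p"
  shows "range (aug_deriv h V E p) = aug_codomain V E"
proof (rule ccontr)
  let ?R = "range (aug_deriv h V E p)"
  assume "?R \<noteq> aug_codomain V E"
  moreover have "?R \<subseteq> aug_codomain V E"
    by (auto simp: aug_codomain_def aug_deriv[OF E p_in_U])
  moreover have R: "subspace ?R"
    by (intro linear_subspace_image linear_aug_deriv E p_in_U subspace_UNIV)
  ultimately have "span ?R \<subset> span (aug_codomain V E)"
    by (metis psubsetI span_eq_iff subspace_aug_codomain)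
  then obtain \<omega> \<mu> where nz: "(\<omega>, \<mu>) \<noteq> 0" and supp: "(\<omega>, \<mu>) \<in> span (aug_codomain V E)"
    and orth: "\<And>y. y \<in> span ?R \<Longrightarrow> orthogonal (\<omega>, \<mu>) y"
    using orthogonal_to_subspace_exists_gen[of ?R "aug_codomain V E"] by (metis surj_pair)
  have supp: "(\<omega>, \<mu>) \<in> aug_codomain V E"
    using supp subspace_aug_codomain by (metis span_eq_iff)
  have orth: "orthogonal (\<omega>, \<mu>) (aug_deriv h V E p u)" for u
    by (rule orth) (simp add: span_base)
  \<comment> \<open>Otherwise moving a single vertex in a direction not tangent to the surface detects a nonzero entry of \<open>\<mu>\<close>.\<close>
  have "\<exists>e\<in>E. \<omega> $ e \<noteq> 0"
  proof (rule ccontr)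
    assume "\<not> (\<exists>e\<in>E. \<omega> $ e \<noteq> 0)"
    then have "\<omega> = 0" using supp by (auto simp: aug_codomain_def vec_eq_iff)
    then obtain i where i: "\<mu> $ i \<noteq> 0" using nz by (auto simp: zero_prod_def vec_eq_iff)
    then have "i \<in> V" using supp by (auto simp: aug_codomain_def)
    then obtain v where v: "frechet_derivative (h i) (at (p $ i)) v \<noteq> 0"
      using gradient p_in_W by (metis ext)
    have "snd (aug_deriv h V E p (axis i v)) = axis i (frechet_derivative (h i) (at (p $ i)) v)"
      using \<open>i \<in> V\<close> linear_0[OF linear_frechet_derivative[OF differentiable_h[OF _ p_in_W]]]
      by (auto simp: aug_deriv[OF E p_in_U] vec_eq_iff axis_def)
    then have "\<mu> $ i * frechet_derivative (h i) (at (p $ i)) v = 0"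
      using orth[of "axis i v"] \<open>\<omega> = 0\<close> by (simp add: orthogonal_def inner_prod_def inner_axis)
    then show False using i v by simp
  qed
  then obtain e where e: "e \<in> E" "\<omega> $ e \<noteq> 0" by blast
  have E': "E - {e} \<subseteq> complete_edges V" using E by blast
  \<comment> \<open>If all other coordinates of the derivative vanish, orthogonality leaves \<open>\<omega> $ e\<close> times the last one.\<close>
  have "aug_deriv h V E p u = 0" if "aug_deriv h V (E - {e}) p u = 0" for u
  proof -
    have "\<forall>f. f \<in> E - {e} \<longrightarrow> edge_deriv p f u = 0"
      "\<forall>i\<in>V. frechet_derivative (h i) (at (p $ i)) (u $ i) = 0"
      using that unfolding aug_deriv[OF E' p_in_U] by (auto simp: zero_prod_def vec_eq_iff) metis+
    then have D: "aug_deriv h V E p u = (axis e (edge_deriv p e u), 0)"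
      using e by (auto simp: aug_deriv[OF E p_in_U] vec_eq_iff axis_def)
    then have "\<omega> $ e * edge_deriv p e u = 0"
      using orth[of u] by (simp add: orthogonal_def inner_axis)
    then show ?thesis using D e by (simp add: zero_prod_def)
  qed
  then have "rigid M V (E - {e}) p"
    using min by (intro redundant_edge E reg) (auto simp: minimally_rigid_def)
  then show False using min e by (auto simp: minimally_rigid_def)
qed

lemma dim_kernel_of_full_rank:
  assumes E: "E \<subseteq> complete_edges V" and "range (aug_deriv h V E p) = aug_codomain V E"
  shows "dim {u \<in> confs V. aug_deriv h V E p u = 0} + card E = 2 * card V"
  using rank_nullity_on_subspace[OF linear_aug_deriv[OF E p_in_U] subspace_confs[of V]] assms
  by (simp add: range_aug_deriv[OF E p_in_U] dim_aug_codomain dim_confs)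

lemma surface_framework_restrict:
  assumes "V' \<subseteq> V" shows "surface_framework M V' (restrict_conf V' p) h W"
proof
  show "restrict_conf V' p \<in> confs_in M V'"
    using p assms by (auto simp: confs_in_def restrict_conf_confs restrict_conf_nth)
  fix i assume i: "i \<in> V'"
  then have "i \<in> V" using assms by blast
  then show "open (W i)" "smooth_on (h i) (W i)" "M \<inter> W i = {y \<in> W i. h i y = 0}"
    by (fact open_W smooth_h level_set)+
  show "restrict_conf V' p $ i \<in> W i" using i \<open>i \<in> V\<close> p_in_W by (simp add: restrict_conf_nth)
  fix y assume "y \<in> W i"
  with \<open>i \<in> V\<close> show "frechet_derivative (h i) (at y) \<noteq> (\<lambda>_. 0)" by (rule gradient)
qed

text \<open>The rows of a subgraph are rows of the graph: its coordinates can be prescribed by prescribing those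
  of the larger graph, with zeros in the additional places.\<close>

lemma full_rank_subgraph:
  assumes E: "E \<subseteq> complete_edges V" and "V' \<subseteq> V" and E': "E' \<subseteq> complete_edges V'" and "E' \<subseteq> E"
    and full: "range (aug_deriv h V E p) = aug_codomain V E"
  shows "range (aug_deriv h V' E' (restrict_conf V' p)) = aug_codomain V' E'"
proof -
  interpret sub: surface_framework M V' "restrict_conf V' p" h W
    using \<open>V' \<subseteq> V\<close> by (rule surface_framework_restrict)
  note D = aug_deriv[OF E p_in_U] and D' = sub.aug_deriv[OF E' sub.p_in_U]
  show ?thesis
  proof (intro subset_antisym subsetI)
    fix z assume z: "z \<in> aug_codomain V' E'"
    then have "z \<in> aug_codomain V E"
      using \<open>V' \<subseteq> V\<close> \<open>E' \<subseteq> E\<close> by (auto simp: aug_codomain_def)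
    then obtain u where u: "z = aug_deriv h V E p u" using full by blast
    have "aug_deriv h V' E' (restrict_conf V' p) u = z"
    proof (rule prod_eqI; rule vec_eq_iff[THEN iffD2]; intro allI)
      fix e show "fst (aug_deriv h V' E' (restrict_conf V' p) u) $ e = fst z $ e"
        using z E' \<open>E' \<subseteq> E\<close> edge_deriv_restrict_conf(1)[of e V' p u] D D' u
        by (cases "e \<in> E'") (auto simp: aug_codomain_def)
    next
      fix i show "snd (aug_deriv h V' E' (restrict_conf V' p) u) $ i = snd z $ i"
        using z \<open>V' \<subseteq> V\<close> D D' u
        by (cases "i \<in> V'") (auto simp: aug_codomain_def restrict_conf_nth)
    qed
    then show "z \<in> range (aug_deriv h V' E' (restrict_conf V' p))" by blast
  qed (auto simp: aug_codomain_def D')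
qed

lemma complete_kernel_subset:
  assumes E: "E \<subseteq> complete_edges V" and "aug_deriv h V (complete_edges V) p u = 0"
  shows "aug_deriv h V E p u = 0"
  using assms(2) E unfolding aug_deriv[OF E p_in_U] aug_deriv[OF order_refl p_in_U]
  by (auto simp: zero_prod_def vec_eq_iff subset_iff) metis+

end

theorem proposition3p4:
  fixes M :: "(real^3) set"
    and V :: "'v::finite set" and E :: "'v set set"
    and p :: "(real^3)^'v"
    and h :: "'v \<Rightarrow> real^3 \<Rightarrow> real"
    and n :: nat
  assumes "embedded_surface M"
    and "simple_graph V E" and "connected_graph V E" and "card V = n"
    and "p \<in> confs_in M V"
    and "\<And>i. i \<in> V \<Longrightarrow> local_defining_function M (p $ i) (h i)"
    and "completely_regular h V E p"
    and "minimally_rigid M V E p"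
  shows "2 * int n - int (card E) = int (ambient_dof h V p) \<and>
    (\<forall>V' E'. subgraph_of V' E' V E \<and> card E' > 0 \<longrightarrow>
       2 * int (card V') - int (card E') \<ge> int (ambient_dof h V' (restrict_conf V' p)))"
proof -
  have E: "E \<subseteq> complete_edges V" using assms(2) by (simp add: simple_graph_def)
  have "\<forall>i\<in>V. \<exists>W. open W \<and> p $ i \<in> W \<and> smooth_on (h i) W \<and>
      (\<forall>y\<in>W. frechet_derivative (h i) (at y) \<noteq> (\<lambda>_. 0)) \<and> M \<inter> W = {y\<in>W. h i y = 0}"
    using assms(6) unfolding local_defining_function_def by blast
  then obtain W where "\<forall>i\<in>V. open (W i) \<and> p $ i \<in> W i \<and> smooth_on (h i) (W i) \<and>
      (\<forall>y\<in>W i. frechet_derivative (h i) (at y) \<noteq> (\<lambda>_. 0)) \<and> M \<inter> W i = {y\<in>W i. h i y = 0}"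
    by (rule bchoice[THEN exE])
  then interpret surface_framework M V p h W
    using assms(5) by unfold_locales auto
  have "subgraph_of V E V E" using assms(2) by (simp add: subgraph_of_def)
  then have reg: "regular h V E p"
    using assms(7) restrict_p unfolding completely_regular_def by metis
  have rigid: "rigid M V E p" using assms(8) by (simp add: minimally_rigid_def)
  have full: "range (aug_deriv h V E p) = aug_codomain V E"
    using E reg assms(8) by (rule minimally_rigid_imp_full_rank)
  have "{u \<in> confs V. aug_deriv h V (complete_edges V) p u = 0} =
      {u \<in> confs V. aug_deriv h V E p u = 0}"
    using rigid_imp_infinitesimally_rigid[OF E reg rigid] complete_kernel_subset[OF E] by blast
  then have "2 * int n - int (card E) = int (ambient_dof h V p)"
    using dim_kernel_of_full_rank[OF E full] assms(4) by (simp add: ambient_dof_def)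
  moreover have "2 * int (card V') - int (card E') \<ge> int (ambient_dof h V' (restrict_conf V' p))"
    if "subgraph_of V' E' V E" for V' E'
  proof -
    have V': "V' \<subseteq> V" and E': "E' \<subseteq> complete_edges V'" and "E' \<subseteq> E"
      using that by (auto simp: subgraph_of_def simple_graph_def)
    interpret sub: surface_framework M V' "restrict_conf V' p" h W
      using V' by (rule surface_framework_restrict)
    have "ambient_dof h V' (restrict_conf V' p)
        \<le> dim {u \<in> confs V'. aug_deriv h V' E' (restrict_conf V' p) u = 0}"
      unfolding ambient_dof_def
      using sub.complete_kernel_subset[OF E'] by (intro dim_subset) blast
    then show ?thesis
      using sub.dim_kernel_of_full_rank[OF E' full_rank_subgraph[OF E V' E' \<open>E' \<subseteq> E\<close> full]] by simp
  qed
  ultimately show ?thesis by blast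
qed

end
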